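(* Let $t > 1$ and let $$a > a_0(t) := \frac{2^{t^2-1} + 2^{t^2-t}}{\left(2^{t-1}-1\right)^{2t-1}}.$$ Then the function $K_{t,a} : \mathbb{R} \times \mathbb{R} \to \mathbb{R}$, $$K_{t,a}(x,y) = \frac{1}{\pi}\cdot\frac{1}{1 + (x-y)^2 + a(x^2+y^2)^t},$$ is not a positive-definite kernel; hence the integral operator $\mathbf{K}_{t,a}$ on $L^2(\mathbb{R})$ with kernel $K_{t,a}$ is not a positive-definite operator.
   Context: For $t>0$, $a>0$, the operator $\mathbf{K}_{t,a} : L^2(\mathbb{R}) \to L^2(\mathbb{R})$ (complex-valued functions) is defined by $\mathbf{K}_{t,a}[c](x) = \int_{\mathbb{R}} K_{t,a}(x,y)\, c(y)\, dy$; it is a bounded (indeed compact) operator on $L^2(\mathbb{R})$. For a nonempty set $X$, a function $K : X \times X \to \mathbb{C}$ is called a positive-definite kernel if $\sum_{j=1}^n \sum_{k=1}^n c_j \overline{c_k} K(x_j,x_k) \geq 0$ for all $n \in \mathbb{N} = \{1,2,\dots\}$, all $(x_1,\dots,x_n) \in X^n$ and all $(c_1,\dots,c_n)\in\mathbb{C}^n$ (so "positive-definite" is meant in the non-strict sense). The operator $\mathbf{K}_{t,a}$ is called positive-definite if $\langle \mathbf{K}_{t,a}[c], c\rangle = \iint_{\mathbb{R}\times\mathbb{R}} K_{t,a}(x,y)\, c(x)\overline{c(y)}\, dy\, dx \geq 0$ for all $c \in L^2(\mathbb{R})$. Convention: $0^t = 0$ for $t>0$. *)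

theory Defs
  imports "HOL-Analysis.Analysis"
begin

text \<open>
  A complex number counts as nonnegative when it lies in \<open>\<real>\<^sub>\<ge>\<^sub>0\<close>, i.e. when it is real and
  nonnegative. Positive definiteness is meant in the non-strict sense throughout.
\<close>

definition positive_definite_kernel :: "'a set \<Rightarrow> ('a \<Rightarrow> 'a \<Rightarrow> complex) \<Rightarrow> bool" where
  "positive_definite_kernel X K \<longleftrightarrow>
     (\<forall>n\<ge>1. \<forall>x :: nat \<Rightarrow> 'a. \<forall>c :: nat \<Rightarrow> complex. (\<forall>j\<in>{1..n}. x j \<in> X) \<longrightarrow>
        (\<Sum>j=1..n. \<Sum>k=1..n. c j * cnj (c k) * K (x j) (x k)) \<in> \<real>\<^sub>\<ge>\<^sub>0)"

text \<open>
  Elements of $L^2$ are represented by square-integrable functions rather than by their classes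
  modulo equality almost everywhere; the inner product and the integral operator
  below only depend on the class.
\<close>

definition L2 :: "(real \<Rightarrow> complex) set" where
  "L2 = {c. c \<in> borel_measurable lebesgue \<and> integrable lebesgue (\<lambda>x. (cmod (c x))\<^sup>2)}"

definition L2_inner :: "(real \<Rightarrow> complex) \<Rightarrow> (real \<Rightarrow> complex) \<Rightarrow> complex" where
  "L2_inner f g = (LINT x|lebesgue. f x * cnj (g x))"

definition integral_operator ::
    "(real \<Rightarrow> real \<Rightarrow> complex) \<Rightarrow> (real \<Rightarrow> complex) \<Rightarrow> (real \<Rightarrow> complex)" where
  "integral_operator K c = (\<lambda>x. LINT y|lebesgue. K x y * c y)"

definition positive_definite_operator :: "((real \<Rightarrow> complex) \<Rightarrow> (real \<Rightarrow> complex)) \<Rightarrow> bool" where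
  "positive_definite_operator T \<longleftrightarrow> (\<forall>c\<in>L2. L2_inner (T c) c \<in> \<real>\<^sub>\<ge>\<^sub>0)"

text \<open>
  Since \<open>0 powr t = 0\<close>, the expression below has the intended value \<open>1 / pi\<close> at the origin.
\<close>

definition K_fun :: "real \<Rightarrow> real \<Rightarrow> real \<Rightarrow> real \<Rightarrow> real" where
  "K_fun t a x y = 1 / pi * (1 / (1 + (x - y)\<^sup>2 + a * (x\<^sup>2 + y\<^sup>2) powr t))"

definition K_op :: "real \<Rightarrow> real \<Rightarrow> (real \<Rightarrow> complex) \<Rightarrow> (real \<Rightarrow> complex)" where
  "K_op t a = integral_operator (\<lambda>x y. complex_of_real (K_fun t a x y))"

definition a\<^sub>0 :: "real \<Rightarrow> real" where
  "a\<^sub>0 t = (2 powr (t\<^sup>2 - 1) + 2 powr (t\<^sup>2 - t)) / (2 powr (t - 1) - 1) powr (2 * t - 1)"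

end

theory Submission
  imports Defs
begin

text \<open>
  A real symmetric positive-definite kernel obeys the Cauchy--Schwarz inequality
  \<open>K(x,y)\<^sup>2 \<le> K(x,x) K(y,y)\<close>, and it is already violated by a pair \<open>{0, r}\<close>.  Put \<open>s = r\<^sup>2\<close>,
  \<open>u = a s\<^sup>t\<close> and \<open>w = 2 powr (t - 1)\<close>.  Up to the common factor \<open>pi\<close>, the
  denominators of \<open>K(0,0)\<close>, \<open>K(0,r)\<close>, \<open>K(r,r)\<close> are \<open>1\<close>, \<open>1 + s + u\<close> and \<open>1 + 2wu\<close>, so a
  violation means \<open>s < sqrt (1 + 2wu) - 1 - u\<close>.  The right-hand side is largest at
  \<open>u = (w\<^sup>2 - 1) / (2w)\<close>, where the square root is \<open>w\<close> and the value is \<open>(w - 1)\<^sup>2 / (2w)\<close>.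
  For this \<open>u\<close> the condition on \<open>s = (u / a) powr (1 / t)\<close> is that \<open>a\<close> exceeds
  \<open>u / ((w - 1)\<^sup>2 / (2w)) powr t\<close>, and this number is the threshold \<open>a\<^sub>0 t\<close>.

  Positive definiteness of the operator implies that of a continuous kernel: test the operator
  on combinations of indicators of short intervals \<open>[x\<^sub>j, x\<^sub>j + h]\<close>, divide by \<open>h\<^sup>2\<close> and let \<open>h\<close>
  tend to \<open>0\<close>.  Hence the operator is not positive-definite either.
\<close>

section \<open>The Cauchy--Schwarz inequality for kernels\<close>

text \<open>
  Each of the coefficient vectors \<open>(- k x y, k x x)\<close> and \<open>(k y y, - k x y)\<close> is orthogonal to one
  row of the matrix of the form, so that the form there equals a diagonal entry times the
  determinant \<open>D\<close>.  This settles the sign of \<open>D\<close> unless both diagonal entries vanish; then the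
  form is \<open>2 u v k x y\<close>, which is nonnegative for all \<open>u\<close> and \<open>v\<close> only if \<open>k x y = 0\<close>.
\<close>

lemma positive_definite_kernel_Cauchy_Schwarz:
  fixes k :: "'a \<Rightarrow> 'a \<Rightarrow> real"
  assumes pd: "positive_definite_kernel X (\<lambda>x y. complex_of_real (k x y))"
    and xy: "x \<in> X" "y \<in> X" and sym: "k y x = k x y"
  shows "(k x y)\<^sup>2 \<le> k x x * k y y"
proof -
  have form: "u\<^sup>2 * k x x + 2 * u * v * k x y + v\<^sup>2 * k y y \<ge> 0" for u v :: real
  proof -
    let ?p = "\<lambda>j::nat. if j = 1 then x else y"
    let ?c = "\<lambda>j::nat. if j = 1 then complex_of_real u else complex_of_real v"
    have "(\<Sum>j=1..2. \<Sum>l=1..2. ?c j * cnj (?c l) * complex_of_real (k (?p j) (?p l))) \<in> \<real>\<^sub>\<ge>\<^sub>0"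
      using pd[unfolded positive_definite_kernel_def, rule_format, of 2 ?p ?c] xy by simp
    moreover have "{1..2::nat} = {1, 2}" by auto
    ultimately have "complex_of_real (u * u * k x x + u * v * k x y + (v * u * k x y + v * v * k y y))
        \<in> \<real>\<^sub>\<ge>\<^sub>0"
      by (simp add: sym)
    then show ?thesis
      unfolding nonneg_Reals_of_real_iff by (simp add: power2_eq_square algebra_simps)
  qed
  define D where "D = k x x * k y y - (k x y)\<^sup>2"
  have x0: "k x x \<ge> 0" and y0: "k y y \<ge> 0"
    using form[of 1 0] form[of 0 1] by simp_all
  have xD: "k x x * D \<ge> 0"
    using form[of "- k x y" "k x x"] by (simp add: D_def power2_eq_square algebra_simps)
  have yD: "k y y * D \<ge> 0"
    using form[of "k y y" "- k x y"] by (simp add: D_def power2_eq_square algebra_simps)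
  have "D \<ge> 0"
  proof (cases "k x x = 0 \<and> k y y = 0")
    case True
    then show ?thesis
      using form[of 1 "- k x y"] by (simp add: D_def power2_eq_square)
  next
    case False
    then show ?thesis
      using x0 y0 xD yD by (metis antisym_conv2 zero_le_mult_iff not_le)
  qed
  then show ?thesis by (simp add: D_def)
qed

section \<open>From the operator to the kernel\<close>

lemma continuous_on_second_argument:
  assumes "continuous_on UNIV (\<lambda>(x, y). K x y)"
  shows "continuous_on S (K x)"
  using continuous_on_compose2[OF assms, of S "Pair x"] by (simp add: continuous_on_Pair)

lemma continuous_on_integral_section:
  fixes K :: "real \<Rightarrow> real \<Rightarrow> 'a :: euclidean_space"
  assumes "continuous_on UNIV (\<lambda>(x, y). K x y)"
  shows "continuous_on S (\<lambda>x. integral {a..b} (K x))"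
proof -
  have "continuous_on UNIV (\<lambda>x. integral (cbox a b) (K x))"
    by (rule integral_continuous_on_param, rule continuous_on_subset[OF assms]) auto
  then show ?thesis by (auto intro: continuous_on_subset)
qed

text \<open>
  The integral is iterated because this is the form in which the operator acting on step functions
  produces it.  Each of the two integrations preserves a bound on \<open>K x y - K p q\<close> that holds
  throughout the small square.
\<close>

lemma square_average_tendsto:
  fixes K :: "real \<Rightarrow> real \<Rightarrow> 'a :: euclidean_space"
  assumes cont: "continuous_on UNIV (\<lambda>(x, y). K x y)"
  shows "((\<lambda>h. (1 / h\<^sup>2) *\<^sub>R integral {p..p+h} (\<lambda>x. integral {q..q+h} (K x))) \<longlongrightarrow> K p q)
           (at_right 0)"
proof (rule tendstoI)
  fix e :: real assume "e > 0"
  then have e2: "e / 2 > 0" by simp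
  obtain d where d: "d > 0"
    and close: "\<And>z. dist z (p, q) < d \<Longrightarrow> dist ((\<lambda>(x, y). K x y) z) (K p q) < e / 2"
    using cont[unfolded continuous_on_iff, rule_format, OF _ e2, of "(p, q)"] by auto
  note cy = continuous_on_second_argument[OF cont]
  note cI = continuous_on_integral_section[OF cont]
  have "\<forall>\<^sub>F h in at_right 0. 0 < h \<and> h < d / 2"
    using d by (intro eventually_at_rightI[of 0 "d / 2"]) auto
  then show "\<forall>\<^sub>F h in at_right 0.
      dist ((1 / h\<^sup>2) *\<^sub>R integral {p..p+h} (\<lambda>x. integral {q..q+h} (K x))) (K p q) < e"
  proof (rule eventually_mono)
    fix h :: real assume h: "0 < h \<and> h < d / 2"
    have near: "norm (K x y - K p q) \<le> e / 2" if "x \<in> {p..p+h}" "y \<in> {q..q+h}" for x y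
    proof -
      have "dist (x, y) (p, q) \<le> \<bar>x - p\<bar> + \<bar>y - q\<bar>"
        unfolding dist_prod_def dist_real_def fst_conv snd_conv
        by (rule order_trans[OF sqrt_sum_squares_le_sum_abs]) simp
      also have "\<dots> < d" using that h by auto
      finally show ?thesis using close[of "(x, y)"] by (simp add: dist_norm)
    qed
    have inner: "norm (integral {q..q+h} (K x) - h *\<^sub>R K p q) \<le> e / 2 * h"
      if "x \<in> {p..p+h}" for x
    proof -
      have "integral {q..q+h} (K x) - h *\<^sub>R K p q = integral {q..q+h} (\<lambda>y. K x y - K p q)"
        using h by (subst integral_diff) (auto intro!: integrable_continuous_real cy)
      also have "norm \<dots> \<le> e / 2 * (q + h - q)"
        using h near[OF that]
        by (intro integral_bound) (auto intro!: continuous_intros cy)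
      finally show ?thesis by simp
    qed
    have "integral {p..p+h} (\<lambda>x. integral {q..q+h} (K x)) - h\<^sup>2 *\<^sub>R K p q
        = integral {p..p+h} (\<lambda>x. integral {q..q+h} (K x) - h *\<^sub>R K p q)"
      using h
      by (subst integral_diff)
        (auto intro!: integrable_continuous_real cI simp: power2_eq_square)
    also have "norm \<dots> \<le> e / 2 * h * (p + h - p)"
      using h inner by (intro integral_bound) (auto intro!: continuous_intros cI)
    finally have bd: "norm (integral {p..p+h} (\<lambda>x. integral {q..q+h} (K x)) - h\<^sup>2 *\<^sub>R K p q)
        \<le> e / 2 * h\<^sup>2"
      by (simp add: power2_eq_square mult.assoc)
    have "(1 / h\<^sup>2) *\<^sub>R integral {p..p+h} (\<lambda>x. integral {q..q+h} (K x)) - K p q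
        = (1 / h\<^sup>2) *\<^sub>R (integral {p..p+h} (\<lambda>x. integral {q..q+h} (K x)) - h\<^sup>2 *\<^sub>R K p q)"
      using h by (simp add: scaleR_diff_right)
    then have "dist ((1 / h\<^sup>2) *\<^sub>R integral {p..p+h} (\<lambda>x. integral {q..q+h} (K x))) (K p q)
        = (1 / h\<^sup>2) * norm (integral {p..p+h} (\<lambda>x. integral {q..q+h} (K x)) - h\<^sup>2 *\<^sub>R K p q)"
      by (simp add: dist_norm)
    also have "\<dots> \<le> (1 / h\<^sup>2) * (e / 2 * h\<^sup>2)"
      using bd by (intro mult_left_mono) auto
    also have "\<dots> < e" using h \<open>e > 0\<close> by simp
    finally show "dist ((1 / h\<^sup>2) *\<^sub>R integral {p..p+h} (\<lambda>x. integral {q..q+h} (K x)))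
        (K p q) < e" by simp
  qed
qed

definition step_fun :: "nat \<Rightarrow> (nat \<Rightarrow> real) \<Rightarrow> (nat \<Rightarrow> complex) \<Rightarrow> real \<Rightarrow> real \<Rightarrow> complex" where
  "step_fun n p b h = (\<lambda>y. \<Sum>j=1..n. b j * indicator {p j..p j + h} y)"

lemma LINT_times_step_fun:
  fixes g :: "real \<Rightarrow> complex"
  assumes "continuous_on UNIV g"
  shows "(LINT y|lebesgue. g y * step_fun n p b h y) = (\<Sum>j=1..n. b j * integral {p j..p j + h} g)"
proof -
  have ai: "g absolutely_integrable_on {p j..p j + h}" for j
    by (rule absolutely_integrable_continuous_real) (rule continuous_on_subset[OF assms], simp)
  have eq: "b j * (indicator {p j..p j + h} y *\<^sub>R g y) = g y * (b j * indicator {p j..p j + h} y)"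
    for j y by (simp add: indicator_def)
  have I: "integrable lebesgue (\<lambda>y. g y * (b j * indicator {p j..p j + h} y))" for j
    using integrable_mult_right[OF ai[of j, unfolded set_integrable_def], of "b j"] eq by simp
  have "(LINT y|lebesgue. g y * (b j * indicator {p j..p j + h} y)) = b j * integral {p j..p j + h} g"
    for j
  proof -
    have "(LINT y|lebesgue. g y * (b j * indicator {p j..p j + h} y))
        = (LINT y|lebesgue. b j * (indicator {p j..p j + h} y *\<^sub>R g y))"
      by (simp only: eq)
    also have "\<dots> = b j * (LINT y:{p j..p j + h}|lebesgue. g y)"
      by (simp add: set_lebesgue_integral_def del: mult_scaleR_right)
    finally show ?thesis by (simp add: set_lebesgue_integral_eq_integral(2)[OF ai])
  qed
  then show ?thesis
    unfolding step_fun_def sum_distrib_left by (subst Bochner_Integration.integral_sum) (auto intro: I)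
qed

lemma cnj_step_fun: "cnj (step_fun n p b h y) = step_fun n p (\<lambda>j. cnj (b j)) h y"
  by (simp add: step_fun_def indicator_def if_distrib cong: if_cong)

lemma step_fun_in_L2: "step_fun n p b h \<in> L2"
proof -
  have I: "integrable lebesgue (\<lambda>y. indicator (A \<inter> B) y :: complex)"
    if "A \<in> lmeasurable" "B \<in> sets lebesgue" for A B :: "real set"
  proof -
    have "integrable lebesgue (\<lambda>y. complex_of_real (indicator (A \<inter> B) y))"
      using fmeasurable_Int_fmeasurable[OF that]
      by (intro integrable_of_real integrable_real_indicator) (auto simp: fmeasurable_def)
    moreover have "complex_of_real (indicator (A \<inter> B) y) = indicator (A \<inter> B) y" for y
      by (cases "y \<in> A \<inter> B") auto
    ultimately show ?thesis by simp
  qed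
  have eq: "complex_of_real ((cmod (step_fun n p b h y))\<^sup>2)
      = (\<Sum>j=1..n. \<Sum>l=1..n. b j * cnj (b l) * indicator ({p j..p j + h} \<inter> {p l..p l + h}) y)" for y
    unfolding complex_norm_square cnj_step_fun
    unfolding step_fun_def sum_product indicator_inter_arith
    by (simp only: mult_ac)
  have "integrable lebesgue (\<lambda>y. complex_of_real ((cmod (step_fun n p b h y))\<^sup>2))"
    unfolding eq by (intro Bochner_Integration.integrable_sum integrable_mult_right I) auto
  moreover have "step_fun n p b h \<in> borel_measurable lebesgue"
    unfolding step_fun_def
    by (intro borel_measurable_sum borel_measurable_times borel_measurable_const
        borel_measurable_indicator) auto
  ultimately show ?thesis
    using integrable_Re[of lebesgue "\<lambda>y. complex_of_real ((cmod (step_fun n p b h y))\<^sup>2)"]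
    by (simp add: L2_def)
qed

text \<open>
  On a step function with intervals of length \<open>h\<close> at the points \<open>p j\<close>, the quadratic form of the
  operator divided by \<open>h\<^sup>2\<close> is the kernel sum with each value \<open>K (p j) (p l)\<close> replaced by an average
  over a small square.  The limit \<open>h \<rightarrow> 0\<close> stays in the closed set of nonnegative reals.
\<close>

lemma positive_definite_kernel_if_operator:
  fixes K :: "real \<Rightarrow> real \<Rightarrow> complex"
  assumes cont: "continuous_on UNIV (\<lambda>(x, y). K x y)"
    and pd: "positive_definite_operator (integral_operator K)"
  shows "positive_definite_kernel UNIV K"
  unfolding positive_definite_kernel_def
proof (intro allI impI)
  fix n :: nat and p :: "nat \<Rightarrow> real" and c :: "nat \<Rightarrow> complex"
  define I where "I h j l = integral {p j..p j + h} (\<lambda>x. integral {p l..p l + h} (K x))" for h j l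
  define F where "F h = (\<Sum>j=1..n. \<Sum>l=1..n. c j * cnj (c l) * ((1 / h\<^sup>2) *\<^sub>R I h j l))" for h
  note cy = continuous_on_second_argument[OF cont]
  note cI = continuous_on_integral_section[OF cont]
  have "F h \<in> \<real>\<^sub>\<ge>\<^sub>0" for h
  proof -
    \<comment> \<open>The inner product conjugates the coefficient of the first kernel argument, the kernel sum
      that of the second, hence the conjugate here.\<close>
    let ?f = "step_fun n p (\<lambda>l. cnj (c l)) h"
    let ?g = "\<lambda>x. \<Sum>l=1..n. cnj (c l) * integral {p l..p l + h} (K x)"
    have "L2_inner (integral_operator K ?f) ?f = (LINT x|lebesgue. ?g x * step_fun n p c h x)"
      by (simp add: L2_inner_def integral_operator_def LINT_times_step_fun[OF cy] cnj_step_fun)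
    also have "\<dots> = (\<Sum>j=1..n. c j * integral {p j..p j + h} ?g)"
      by (intro LINT_times_step_fun continuous_intros cI)
    also have "\<dots> = (\<Sum>j=1..n. \<Sum>l=1..n. c j * cnj (c l) * I h j l)"
    proof (intro sum.cong refl)
      fix j
      have "integral {p j..p j + h} ?g = (\<Sum>l=1..n. cnj (c l) * I h j l)"
        unfolding I_def
        by (subst integral_sum)
          (auto intro!: integrable_continuous_real continuous_intros cI)
      then show "c j * integral {p j..p j + h} ?g = (\<Sum>l=1..n. c j * cnj (c l) * I h j l)"
        by (simp add: sum_distrib_left mult.assoc)
    qed
    finally have eq: "L2_inner (integral_operator K ?f) ?f
        = (\<Sum>j=1..n. \<Sum>l=1..n. c j * cnj (c l) * I h j l)" .
    have "F h = complex_of_real (1 / h\<^sup>2) * L2_inner (integral_operator K ?f) ?f"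
      unfolding eq F_def
      by (simp add: sum_distrib_left scaleR_conv_of_real mult_ac)
    moreover have "L2_inner (integral_operator K ?f) ?f \<in> \<real>\<^sub>\<ge>\<^sub>0"
      using pd step_fun_in_L2 by (auto simp: positive_definite_operator_def)
    moreover have "complex_of_real (1 / h\<^sup>2) \<in> \<real>\<^sub>\<ge>\<^sub>0"
      by (subst nonneg_Reals_of_real_iff) simp
    ultimately show ?thesis using nonneg_Reals_mult_I by metis
  qed
  moreover have "(F \<longlongrightarrow> (\<Sum>j=1..n. \<Sum>l=1..n. c j * cnj (c l) * K (p j) (p l))) (at_right 0)"
    unfolding F_def I_def by (intro tendsto_intros square_average_tendsto cont)
  ultimately show "(\<Sum>j=1..n. \<Sum>l=1..n. c j * cnj (c l) * K (p j) (p l)) \<in> \<real>\<^sub>\<ge>\<^sub>0"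
    by (intro Lim_in_closed_set[OF closed_nonneg_Reals_complex]) auto
qed

section \<open>The pair of points for large \<open>a\<close>\<close>

lemma continuous_on_K_fun:
  assumes "t > 0" "a \<ge> 0"
  shows "continuous_on UNIV (\<lambda>(x, y). complex_of_real (K_fun t a x y))"
proof -
  have "1 + (x - y)\<^sup>2 + a * (x\<^sup>2 + y\<^sup>2) powr t > 0" for x y :: real
    using assms by (intro add_pos_nonneg) auto
  then have "1 + (x - y)\<^sup>2 + a * (x\<^sup>2 + y\<^sup>2) powr t \<noteq> 0" for x y :: real
    by (metis less_irrefl)
  then show ?thesis
    unfolding K_fun_def split_def using assms
    by (intro continuous_intros continuous_on_powr') auto
qed

text \<open>
  The witness is \<open>r = sqrt s\<close>, where \<open>a s\<^sup>t = (w\<^sup>2 - 1) / (2w)\<close> and \<open>w = 2 powr (t - 1)\<close>.  Up to the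
  factor \<open>pi\<close>, the denominators at \<open>(0, 0)\<close> and \<open>(r, r)\<close> are then \<open>1\<close> and \<open>w\<^sup>2\<close>, so the one at
  \<open>(0, r)\<close> has to be less than \<open>w\<close>.  That means \<open>s < (w - 1)\<^sup>2 / (2w)\<close>, which in turn is equivalent to \<open>a\<^sub>0 t < a\<close>.
\<close>

lemma K_fun_violates_Cauchy_Schwarz:
  assumes t: "t > 1" and a: "a > a\<^sub>0 t"
  obtains r where "K_fun t a 0 0 * K_fun t a r r < (K_fun t a 0 r)\<^sup>2"
proof -
  define w where "w = 2 powr (t - 1)"
  define u where "u = (w\<^sup>2 - 1) / (2 * w)"
  define s0 where "s0 = (w - 1)\<^sup>2 / (2 * w)"
  define s where "s = (u / a) powr (1 / t)"
  have w1: "w > 1" using t by (simp add: w_def)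
  have two_w: "2 powr t = 2 * w" by (simp add: w_def powr_diff)
  have u0: "u > 0" using w1 by (simp add: u_def one_less_power)
  have s00: "s0 > 0" using w1 by (simp add: s0_def)
  \<comment> \<open>The threshold is the value of \<open>a\<close> at which \<open>s\<close> reaches \<open>s0\<close>.\<close>
  have a0: "a\<^sub>0 t = u / s0 powr t"
  proof -
    have num: "2 powr (t\<^sup>2 - 1) + 2 powr (t\<^sup>2 - t) = (w + 1) * w powr t"
      by (simp add: w_def powr_powr power2_eq_square algebra_simps flip: powr_add)
    have "(w - 1) powr (2 * t) = (w - 1) powr (2 * t - 1) * (w - 1) powr 1"
      by (subst powr_add[symmetric]) simp
    then have wm: "((w - 1)\<^sup>2) powr t = (w - 1) powr (2 * t - 1) * (w - 1)"
      using w1 by (simp add: powr_powr flip: powr_numeral)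
    have w2: "(2 * w) powr t = 2 * w * w powr t"
      using w1 by (simp add: powr_mult two_w)
    have "u / s0 powr t = (w\<^sup>2 - 1) / (2 * w) * ((2 * w * w powr t) / ((w - 1) powr (2 * t - 1) * (w - 1)))"
      using w1 by (simp add: u_def s0_def powr_divide wm w2)
    also have "\<dots> = (w + 1) * w powr t / (w - 1) powr (2 * t - 1)"
      using w1 by (simp add: divide_simps) (simp add: power2_eq_square algebra_simps)
    finally show ?thesis by (simp add: a\<^sub>0_def num flip: w_def)
  qed
  have "u / s0 powr t > 0" using u0 s00 by simp
  then have apos: "a > 0" using a a0 by linarith
  have spos: "s > 0" using u0 apos by (simp add: s_def)
  have as: "a * s powr t = u"
    using t u0 apos by (simp add: s_def powr_powr)
  have "s < s0"
  proof -
    have "u / a < s0 powr t"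
      using a a0 apos s00 by (simp add: divide_simps mult.commute)
    then have "s < (s0 powr t) powr (1 / t)"
      using t u0 apos by (auto simp: s_def intro: powr_less_mono2)
    then show ?thesis using t s00 by (simp add: powr_powr)
  qed
  have "1 + s0 + u = w"
    using w1 by (simp add: s0_def u_def field_simps power2_eq_square)
  with \<open>s < s0\<close> have d: "1 + s + u < w" by linarith
  have diag: "1 + a * (2 * s) powr t = w\<^sup>2"
  proof -
    have "(2 * s) powr t = 2 * w * s powr t"
      using spos powr_mult[of 2 s t] by (simp add: two_w)
    then have "1 + a * (2 * s) powr t = 1 + 2 * w * u" using as by simp
    then show ?thesis using w1 by (simp add: u_def)
  qed
  have r2: "(sqrt s)\<^sup>2 = s" using spos by simp
  have K00: "K_fun t a 0 0 = 1 / pi" by (simp add: K_fun_def)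
  have Krr: "K_fun t a (sqrt s) (sqrt s) = 1 / pi * (1 / w\<^sup>2)"
    by (simp add: K_fun_def r2 diag)
  have K0r: "K_fun t a 0 (sqrt s) = 1 / pi * (1 / (1 + s + u))"
    by (simp add: K_fun_def r2 as)
  have "(1 + s + u)\<^sup>2 < w\<^sup>2"
    using d spos u0 by (intro power_strict_mono) auto
  then have "1 / w\<^sup>2 < 1 / (1 + s + u)\<^sup>2"
    using spos u0 by (intro divide_strict_left_mono) (auto simp: w1 intro!: mult_pos_pos)
  then have "1 / pi\<^sup>2 * (1 / w\<^sup>2) < 1 / pi\<^sup>2 * (1 / (1 + s + u)\<^sup>2)"
    by (intro mult_strict_left_mono) auto
  then have "K_fun t a 0 0 * K_fun t a (sqrt s) (sqrt s) < (K_fun t a 0 (sqrt s))\<^sup>2"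
    unfolding K00 Krr K0r by (simp add: power2_eq_square mult_ac)
  then show ?thesis by (rule that)
qed

theorem proposition2:
  fixes t a :: real
  assumes "t > 1" and "a > a\<^sub>0 t"
  shows "\<not> positive_definite_kernel (UNIV :: real set) (\<lambda>x y. complex_of_real (K_fun t a x y)) \<and>
         \<not> positive_definite_operator (K_op t a)"
proof -
  have "a\<^sub>0 t \<ge> 0" by (simp add: a\<^sub>0_def)
  then have "a \<ge> 0" using assms by simp
  obtain r where r: "K_fun t a 0 0 * K_fun t a r r < (K_fun t a 0 r)\<^sup>2"
    using K_fun_violates_Cauchy_Schwarz[OF assms] .
  have "K_fun t a r 0 = K_fun t a 0 r"
    by (simp add: K_fun_def)
  then have not_kernel:
    "\<not> positive_definite_kernel UNIV (\<lambda>x y. complex_of_real (K_fun t a x y))"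
    using positive_definite_kernel_Cauchy_Schwarz[of UNIV "K_fun t a" 0 r] r by auto
  moreover have "\<not> positive_definite_operator (K_op t a)"
    using positive_definite_kernel_if_operator[OF continuous_on_K_fun[of t a]] not_kernel
      assms \<open>a \<ge> 0\<close> by (auto simp: K_op_def)
  ultimately show ?thesis by blast
qed

end
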